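(* Let $q$ be a prime power, $s\ge 2$, and let the bases $\mathfrak{B}_{m,i}$, the maps $\theta_m$, the set $Y$ and the reductions $\boldsymbol{\alpha}^{(m)}$ be as in the context. For $\boldsymbol{\alpha}\in Y^s$ and $m\in\mathbb{N}$ let $\mathcal{N}'_{\boldsymbol{\alpha}^{(m)}}=\{\mathbf{k}\in R_m^s:\ \boldsymbol{\alpha}^{(m)}\cdot\mathbf{k}\equiv 0\pmod{x^m}\}$ and $\mathcal{N}_{\boldsymbol{\alpha}^{(m)}}=\theta_m(\mathcal{N}'_{\boldsymbol{\alpha}^{(m)}})\subseteq\mathbb{F}_q^{sm}$. Then the sequence $(\mathcal{N}_{\boldsymbol{\alpha}^{(m)}})_{m\ge1}$ is a dual space chain.
   Context: $\mathbb{F}_q$ is the finite field with $q$ elements. For $m\in\mathbb{N}$, $R_m:=\mathbb{F}_q[x]/(x^m)$, whose elements are identified with polynomials of degree $<m$. For each $i=1,\ldots,s$ and each $m\in\mathbb{N}$ an ordered basis $\mathfrak{B}_{m,i}=\{\mathfrak{b}_{m,i,1},\ldots,\mathfrak{b}_{m,i,m}\}$ of $R_m$ over $\mathbb{F}_q$ is fixed such that for all $1\le j\le m$ the coefficient vector of $\mathfrak{b}_{m+1,i,j}$ with respect to $\{1,x,\ldots,x^m\}$ equals the coefficient vector of $\mathfrak{b}_{m,i,j}$ with respect to $\{1,x,\ldots,x^{m-1}\}$ with a $0$ appended. The map $\theta_m:R_m^s\to\mathbb{F}_q^{sm}$ sends $(k_1,\ldots,k_s)$ to the concatenation of the coordinate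 vectors of $k_1,\ldots,k_s$ with respect to $\mathfrak{B}_{m,1},\ldots,\mathfrak{B}_{m,s}$ respectively. $Y=\{\alpha\in\mathbb{F}_q[[x]]:\ \gcd(\alpha\bmod x^m,x^m)=1 \text{ for all } m\in\mathbb{N}\}$, and for $\boldsymbol{\alpha}\in Y^s$, $\boldsymbol{\alpha}^{(m)}\in R_m^s$ is the coordinatewise reduction of $\boldsymbol{\alpha}$ modulo $x^m$; $\boldsymbol{\alpha}^{(m)}\cdot\mathbf{k}=\sum_i\alpha_i^{(m)}k_i$. Dual space chain: for each $m\in\mathbb{N}$ let $\mathcal{N}_m$ be an $\mathbb{F}_q$-linear subspace of $\mathbb{F}_q^{sm}$ with codimension at most $m$. Let $\mathcal{N}_{m+1,m}=\{(\mathbf{a}_1,\ldots,\mathbf{a}_s)\in\mathbb{F}_q^{sm}:\ \mathbf{a}_i\in\mathbb{F}_q^m,\ ((\mathbf{a}_1,0),\ldots,(\mathbf{a}_s,0))\in\mathcal{N}_{m+1}\}$. If for all $m$, $\mathcal{N}_{m+1,m}$ is a subspace of $\mathcal{N}_m$ with $\dim(\mathcal{N}_m/\mathcal{N}_{m+1,m})\le 1$, then $(\mathcal{N}_m)_{m\ge1}$ is called a dual space chain. *)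

theory Defs
  imports
    "HOL-Number_Theory.Cong"
    "HOL-Computational_Algebra.Polynomial_FPS"
    "HOL-Algebra.AbelCoset"
    "Jordan_Normal_Form.VS_Connect"
begin

text \<open>
  The field \<open>\<F>\<^sub>q\<close> is a finite field type \<open>'a\<close>, viewed as the structure \<open>class_ring\<close>
  when it acts as the scalar field of a carrier-based vector space. All tuples, ordered bases and
  coordinates are indexed from \<open>0\<close>: \<open>i < s\<close> stands for \<open>1 \<le> i \<le> s\<close>, and \<open>j < m\<close> for \<open>1 \<le> j \<le> m\<close>.
  The index \<open>m\<close> ranges over the positive integers.
\<close>


subsection \<open>Quotient spaces\<close>

text \<open>The fields \<open>mult\<close> and \<open>one\<close> of a module record play no role in the vector space structure.\<close>

definition quotient_space :: "('k, 'v, 'c) module_scheme \<Rightarrow> 'v set \<Rightarrow> ('k, 'v set) module" where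
  "quotient_space V W = \<lparr>
     carrier = a_rcosets\<^bsub>V\<^esub> W,
     mult = undefined,
     one = undefined,
     zero = W,
     add = (\<lambda>X Y. X <+>\<^bsub>V\<^esub> Y),
     smult = (\<lambda>c X. \<Union>x\<in>X. W +>\<^bsub>V\<^esub> (c \<odot>\<^bsub>V\<^esub> x))\<rparr>"

definition quotient_dim ::
    "('k, 'r) ring_scheme \<Rightarrow> ('k, 'v, 'c) module_scheme \<Rightarrow> 'v set \<Rightarrow> nat" where
  "quotient_dim K V W = vectorspace.dim K (quotient_space V W)"

lemma (in submodule) is_additive_subgroup: "additive_subgroup N M"
proof -
  interpret module R M by (rule module)
  show ?thesis
  proof (rule additive_subgroup.intro, unfold_locales)
    show "N \<subseteq> carrier (add_monoid M)" using subset by simp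
    fix x y assume x: "x \<in> N" and y: "y \<in> N"
    then show "x \<otimes>\<^bsub>add_monoid M\<^esub> y \<in> N" by simp
    have xM: "x \<in> carrier M" using x subset by auto
    have "(\<ominus>\<^bsub>R\<^esub> \<one>\<^bsub>R\<^esub>) \<odot>\<^bsub>M\<^esub> x \<in> N" using x by auto
    moreover have "(\<ominus>\<^bsub>R\<^esub> \<one>\<^bsub>R\<^esub>) \<odot>\<^bsub>M\<^esub> x = \<ominus>\<^bsub>M\<^esub> x" using xM
      by (simp add: smult_l_minus)
    ultimately show "inv\<^bsub>add_monoid M\<^esub> x \<in> N" by (simp add: a_inv_def)
  qed simp
qed

lemma quotient_space_simps:
  "carrier (quotient_space V W) = a_rcosets\<^bsub>V\<^esub> W"
  "\<zero>\<^bsub>quotient_space V W\<^esub> = W"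
  "X \<oplus>\<^bsub>quotient_space V W\<^esub> Y = X <+>\<^bsub>V\<^esub> Y"
  "c \<odot>\<^bsub>quotient_space V W\<^esub> X = (\<Union>x\<in>X. W +>\<^bsub>V\<^esub> (c \<odot>\<^bsub>V\<^esub> x))"
  by (simp_all add: quotient_space_def)

context subspace begin

lemma quotient_smult_coset:
  assumes c: "c \<in> carrier K" and x: "x \<in> carrier V"
  shows "c \<odot>\<^bsub>quotient_space V W\<^esub> (W +>\<^bsub>V\<^esub> x) = W +>\<^bsub>V\<^esub> (c \<odot>\<^bsub>V\<^esub> x)"
proof -
  interpret vectorspace K V by (rule vs)
  interpret sm: submodule K W V by (rule submod)
  interpret ag: additive_subgroup W V by (rule sm.is_additive_subgroup)
  interpret aas: abelian_subgroup W V
    by (rule abelian_subgroupI3) (unfold_locales)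
  have "W +>\<^bsub>V\<^esub> (c \<odot>\<^bsub>V\<^esub> y) = W +>\<^bsub>V\<^esub> (c \<odot>\<^bsub>V\<^esub> x)" if y: "y \<in> W +>\<^bsub>V\<^esub> x" for y
  proof -
    from y obtain w where w: "w \<in> W" "y = w \<oplus>\<^bsub>V\<^esub> x"
      by (auto simp: a_r_coset_def r_coset_def)
    have wV: "w \<in> carrier V" using w sm.subset by auto
    have "c \<odot>\<^bsub>V\<^esub> y = c \<odot>\<^bsub>V\<^esub> w \<oplus>\<^bsub>V\<^esub> c \<odot>\<^bsub>V\<^esub> x"
      using w wV x c by (simp add: smult_r_distr)
    moreover have "c \<odot>\<^bsub>V\<^esub> w \<in> W" using w c by auto
    ultimately have "c \<odot>\<^bsub>V\<^esub> y \<in> W +>\<^bsub>V\<^esub> (c \<odot>\<^bsub>V\<^esub> x)"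
      by (auto simp: a_r_coset_def r_coset_def)
    then show ?thesis
      using a_repr_independence c x ag.a_subgroup by (metis smult_closed)
  qed
  moreover have "x \<in> W +>\<^bsub>V\<^esub> x" using x aas.a_rcos_self by blast
  ultimately show ?thesis unfolding quotient_space_simps by blast
qed

lemma quotient_is_vs: "vectorspace K (quotient_space V W)"
  and quotient_linear_map: "linear_map K V (quotient_space V W) (\<lambda>x. W +>\<^bsub>V\<^esub> x)"
proof -
  interpret vectorspace K V by (rule vs)
  interpret sm: submodule K W V by (rule submod)
  interpret ag: additive_subgroup W V by (rule sm.is_additive_subgroup)
  interpret aas: abelian_subgroup W V
    by (rule abelian_subgroupI3) (unfold_locales)
  let ?Q = "quotient_space V W"
  have add: "(W +>\<^bsub>V\<^esub> x) \<oplus>\<^bsub>?Q\<^esub> (W +>\<^bsub>V\<^esub> y) = W +>\<^bsub>V\<^esub> (x \<oplus>\<^bsub>V\<^esub> y)"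
    if "x \<in> carrier V" "y \<in> carrier V" for x y
    using that by (simp add: quotient_space_simps aas.a_rcos_sum)
  note sm' = quotient_smult_coset
  have car: "carrier ?Q = (\<lambda>x. W +>\<^bsub>V\<^esub> x) ` carrier V"
    by (auto simp: quotient_space_simps A_RCOSETS_def')
  have zero: "\<zero>\<^bsub>?Q\<^esub> = W +>\<^bsub>V\<^esub> \<zero>\<^bsub>V\<^esub>"
    using ag.a_subset by (simp add: quotient_space_simps)
  have modQ: "module K ?Q"
  proof (rule module.intro)
    show "cring K" by unfold_locales
    show "abelian_group ?Q"
    proof (rule abelian_groupI)
      fix X assume "X \<in> carrier ?Q"
      then obtain x where x: "x \<in> carrier V" "X = W +>\<^bsub>V\<^esub> x" by (auto simp: car)
      show "\<exists>Y\<in>carrier ?Q. Y \<oplus>\<^bsub>?Q\<^esub> X = \<zero>\<^bsub>?Q\<^esub>"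
        by (rule bexI[of _ "W +>\<^bsub>V\<^esub> (\<ominus>\<^bsub>V\<^esub> x)"]) (use x in \<open>auto simp: car add zero l_neg\<close>)
    qed (auto simp: car add zero a_ac image_iff)
    show "module_axioms K ?Q"
      by (rule module_axioms.intro)
        (auto simp: car add sm' smult_l_distr smult_r_distr smult_assoc1)
  qed
  show vsQ: "vectorspace K ?Q" by (rule vectorspace.intro[OF modQ field_axioms])
  show "linear_map K V ?Q (\<lambda>x. W +>\<^bsub>V\<^esub> x)"
    by (rule linear_map.intro[OF vs vsQ mod_hom.intro[OF module_axioms modQ mod_hom_axioms.intro]])
      (auto simp: module_hom_def car add sm')
qed

lemma quotient_dim_add:
  assumes "vectorspace.fin_dim K V"
  shows "quotient_dim K V W + vectorspace.dim K (V\<lparr>carrier := W\<rparr>) = vectorspace.dim K V"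
proof -
  interpret sm: submodule K W V by (rule submod)
  interpret ag: additive_subgroup W V by (rule sm.is_additive_subgroup)
  interpret L: linear_map K V "quotient_space V W" "\<lambda>x. W +>\<^bsub>V\<^esub> x"
    by (rule quotient_linear_map)
  interpret aas: abelian_subgroup W V
    by (rule abelian_subgroupI3) (unfold_locales)
  have im: "L.imT = carrier (quotient_space V W)"
    by (auto simp: L.im_def quotient_space_simps A_RCOSETS_def')
  have ker: "L.kerT = W"
    using sm.subset aas.a_rcos_self aas.a_rcos_const
    unfolding L.ker_def quotient_space_simps
    by blast
  show ?thesis
    using L.rank_nullity[OF assms] unfolding im ker quotient_dim_def by simp
qed

end


subsection \<open>Dual space chains\<close>

abbreviation coord_space :: "nat \<Rightarrow> ('a::field, 'a vec) module" where
  "coord_space n \<equiv> module_vec TYPE('a) n"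

definition concat_blocks :: "nat \<Rightarrow> nat \<Rightarrow> (nat \<Rightarrow> 'a vec) \<Rightarrow> 'a vec" where
  "concat_blocks s m a = vec (s * m) (\<lambda>t. a (t div m) $ (t mod m))"

text \<open>The space \<open>\<N>\<^bsub>m+1,m\<^esub>\<close>, as a function of \<open>N = \<N>\<^bsub>m+1\<^esub>\<close>.\<close>

definition shortened :: "nat \<Rightarrow> nat \<Rightarrow> 'a::zero vec set \<Rightarrow> 'a vec set" where
  "shortened s m N =
     {concat_blocks s m a | a.
        (\<forall>i<s. a i \<in> carrier_vec m) \<and>
        concat_blocks s (Suc m) (\<lambda>i. a i @\<^sub>v 0\<^sub>v 1) \<in> N}"

definition dual_space_chain :: "nat \<Rightarrow> (nat \<Rightarrow> 'a::field vec set) \<Rightarrow> bool" where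
  "dual_space_chain s N \<longleftrightarrow>
     (\<forall>m\<ge>1. subspace class_ring (N m) (coord_space (s * m)) \<and>
            quotient_dim class_ring (coord_space (s * m)) (N m) \<le> m) \<and>
     (\<forall>m\<ge>1. subspace class_ring (shortened s m (N (Suc m)))
              ((coord_space (s * m))\<lparr>carrier := N m\<rparr>) \<and>
            quotient_dim class_ring ((coord_space (s * m))\<lparr>carrier := N m\<rparr>)
              (shortened s m (N (Suc m))) \<le> 1)"


subsection \<open>The rings \<open>\<F>\<^sub>q[x]/(x\<^sup>m)\<close> and their bases\<close>

text \<open>Residue classes are represented by the polynomials of degree \<open>< m\<close>.\<close>

definition R_alg :: "nat \<Rightarrow> ('a::field, 'a poly) module" where
  "R_alg m = \<lparr>
     carrier = {p. p = 0 \<or> degree p < m},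
     mult = (\<lambda>p r. (p * r) mod monom 1 m),
     one = 1 mod monom 1 m,
     zero = 0,
     add = (+),
     smult = Polynomial.smult\<rparr>"

lemma R_alg_vs: "vectorspace class_ring (R_alg m :: ('a::field, 'a poly) module)"
proof -
  let ?R = "R_alg m :: ('a::field, 'a poly) module"
  have car: "carrier ?R = {p. \<forall>j\<ge>m. coeff p j = 0}"
    unfolding R_alg_def
    by (auto simp: coeff_eq_0) (metis leading_coeff_0_iff not_le)
  have "module class_ring ?R"
  proof (rule module.intro)
    show "cring (class_ring :: 'a ring)" by unfold_locales
    show "abelian_group ?R"
    proof (rule abelian_groupI)
      fix x assume "x \<in> carrier ?R"
      then show "\<exists>y\<in>carrier ?R. y \<oplus>\<^bsub>?R\<^esub> x = \<zero>\<^bsub>?R\<^esub>"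
        by (intro bexI[of _ "- x"]) (auto simp: car, auto simp: R_alg_def)
    qed (auto simp: car, auto simp: R_alg_def)
    show "module_axioms class_ring ?R"
      by (rule module_axioms.intro)
        (auto simp: car, auto simp: R_alg_def smult_add_left smult_add_right)
  qed
  then show ?thesis by (intro vectorspace.intro class_field)
qed

definition ordered_basis :: "nat \<Rightarrow> (nat \<Rightarrow> 'a::field poly) \<Rightarrow> bool" where
  "ordered_basis m b \<longleftrightarrow>
     inj_on b {..<m} \<and> vectorspace.basis class_ring (R_alg m) (b ` {..<m})"

text \<open>\<open>B m i j\<close> is the \<open>j\<close>-th element of the \<open>i\<close>-th ordered basis of \<open>R_alg m\<close>.\<close>

definition nested_bases :: "nat \<Rightarrow> (nat \<Rightarrow> nat \<Rightarrow> nat \<Rightarrow> 'a::field poly) \<Rightarrow> bool" where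
  "nested_bases s B \<longleftrightarrow>
     (\<forall>m\<ge>1. \<forall>i<s. ordered_basis m (B m i)) \<and>
     (\<forall>m\<ge>1. \<forall>i<s. \<forall>j<m.
        vec (Suc m) (coeff (B (Suc m) i j)) = vec m (coeff (B m i j)) @\<^sub>v 0\<^sub>v 1)"

definition coord_vec :: "nat \<Rightarrow> (nat \<Rightarrow> 'a::field poly) \<Rightarrow> 'a poly \<Rightarrow> 'a vec" where
  "coord_vec m b p =
     (THE v. v \<in> carrier_vec m \<and> p = (\<Sum>j<m. Polynomial.smult (v $ j) (b j)))"

definition theta ::
    "nat \<Rightarrow> (nat \<Rightarrow> nat \<Rightarrow> nat \<Rightarrow> 'a::field poly) \<Rightarrow> nat \<Rightarrow> (nat \<Rightarrow> 'a poly) \<Rightarrow> 'a vec" where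
  "theta s B m k = concat_blocks s m (\<lambda>i. coord_vec m (B m i) (k i))"


subsection \<open>The spaces determined by a tuple of power series\<close>

text \<open>
  \<open>truncate_fps m \<alpha>\<close> is the representative of \<open>\<alpha>\<close> modulo \<open>x\<^sup>m\<close>. The condition
  \<open>gcd(\<cdot>, x\<^sup>m) = 1\<close> is expressed by \<open>coprime\<close>, since \<open>gcd\<close> on polynomials is only
  available over coefficient types of class \<open>field_gcd\<close>.
\<close>

definition Y_set :: "'a::field fps set" where
  "Y_set = {\<alpha>. \<forall>m\<ge>1. coprime (truncate_fps m \<alpha>) (monom 1 m)}"

definition N_prime :: "nat \<Rightarrow> (nat \<Rightarrow> 'a::field fps) \<Rightarrow> nat \<Rightarrow> (nat \<Rightarrow> 'a poly) set" where
  "N_prime s \<alpha> m =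
     {k \<in> {..<s} \<rightarrow>\<^sub>E carrier (R_alg m).
        [(\<Sum>i<s. truncate_fps m (\<alpha> i) * k i) = 0] (mod (monom 1 m))}"

definition N_space ::
    "nat \<Rightarrow> (nat \<Rightarrow> nat \<Rightarrow> nat \<Rightarrow> 'a::field poly) \<Rightarrow> (nat \<Rightarrow> 'a fps) \<Rightarrow> nat \<Rightarrow> 'a vec set" where
  "N_space s B \<alpha> m = theta s B m ` N_prime s \<alpha> m"

end

theory Submission
  imports Defs "Jordan_Normal_Form.DL_Rank"
begin

text \<open>
  In coordinates, \<open>\<N>\<^sub>m\<close> is cut out of \<open>\<F>\<^sub>q\<^sup>s\<^sup>m\<close> by \<open>m\<close> linear functionals: the coefficients of
  \<open>x\<^sup>0, \<dots>, x\<^sup>m\<^sup>-\<^sup>1\<close> in \<open>\<alpha> \<cdot> k\<close>. So its codimension is at most \<open>m\<close>. Nestedness makes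
  the first \<open>m\<close> elements of the bases for \<open>m + 1\<close> the same polynomials as those for \<open>m\<close>, so
  \<open>\<N>\<^bsub>m+1,m\<^esub>\<close> is cut out of the same space by these functionals and one more, the
  coefficient of \<open>x\<^sup>m\<close>.
\<close>

section \<open>Codimension of kernels of linear maps\<close>

text \<open>An independent subset of \<open>W\<close> stays independent in \<open>V\<close>, so its
  size is at most \<open>dim\<close>; hence a maximal one exists, and it is a finite basis of
  \<open>W\<close>.\<close>

lemma (in vectorspace) subspace_fin_dim:
  assumes W: "subspace K W V" and fd: "fin_dim"
  shows "vectorspace.fin_dim K (vs W)"
proof -
  interpret W: vectorspace K "vs W" by (rule subspace_is_vs[OF W])
  have sm: "submodule K W V" and WV: "W \<subseteq> carrier V"
    using W by (auto simp: subspace_def submodule_def)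
  let ?P = "\<lambda>S. S \<subseteq> carrier (vs W) \<and> \<not> W.lin_dep S"
  have bound: "finite A \<and> card A \<le> dim" if "?P A" for A
  proof -
    have "A \<subseteq> carrier V" "lin_indpt A"
      using that span_li_not_depend(2)[OF _ sm, of A] WV by auto
    then show ?thesis using li_le_dim[OF fd] by blast
  qed
  have "?P {}" by (auto simp: W.lin_dep_def)
  from maximal_exists[of ?P, OF bound this]
  obtain A where A: "finite A" "maximal A ?P" by blast
  have "W.basis A" by (rule W.max_li_is_basis[OF A(2)])
  with A(1) show ?thesis unfolding W.fin_dim_def W.basis_def by blast
qed

text \<open>By rank-nullity, the codimension of the kernel is the dimension of the image, which is a
  subspace of \<open>W\<close>.\<close>

lemma quotient_dim_kernel_le:
  assumes T: "linear_map K V W T" and V: "vectorspace.fin_dim K V" and W: "vectorspace.fin_dim K W"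
  shows "quotient_dim K V {v \<in> carrier V. T v = \<zero>\<^bsub>W\<^esub>} \<le> vectorspace.dim K W"
proof -
  interpret T: linear_map K V W T by (rule T)
  have "quotient_dim K V T.kerT + vectorspace.dim K (V\<lparr>carrier := T.kerT\<rparr>) = vectorspace.dim K V"
    by (rule subspace.quotient_dim_add[OF T.kerT_is_subspace V])
  with T.rank_nullity[OF V]
  have "quotient_dim K V T.kerT = vectorspace.dim K (W\<lparr>carrier := T.imT\<rparr>)" by simp
  also have "\<dots> \<le> vectorspace.dim K W"
    by (intro T.W.subspace_dim T.imT_is_subspace W T.W.subspace_fin_dim)
  finally show ?thesis unfolding T.ker_def .
qed

text \<open>The functionals are the components of one linear map into \<open>coord_space n\<close>.
  An arbitrary module record \<open>V\<close> lets the result serve both for the full coordinate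
  space with \<open>m\<close> functionals and for the \<open>m\<close>-th space of the chain as
  ambient space with one.\<close>

lemma common_kernel_of_functionals:
  fixes V :: "('a::field, 'v, 'c) module_scheme"
  assumes V: "vectorspace class_ring V" "vectorspace.fin_dim class_ring V"
    and add: "\<And>t v w. t < n \<Longrightarrow> v \<in> carrier V \<Longrightarrow> w \<in> carrier V \<Longrightarrow> f t (v \<oplus>\<^bsub>V\<^esub> w) = f t v + f t w"
    and smult: "\<And>t c v. t < n \<Longrightarrow> v \<in> carrier V \<Longrightarrow> f t (c \<odot>\<^bsub>V\<^esub> v) = c * f t v"
  shows "subspace class_ring {v \<in> carrier V. \<forall>t<n. f t v = 0} V"
    and "quotient_dim class_ring V {v \<in> carrier V. \<forall>t<n. f t v = 0} \<le> n"
proof -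
  let ?T = "\<lambda>v. vec n (\<lambda>t. f t v)"
  have T: "linear_map class_ring V (coord_space n) ?T"
    using V(1) vec_vs[where 'a = 'a]
    by (intro linear_map.intro mod_hom.intro mod_hom_axioms.intro)
      (auto simp: vectorspace_def module_hom_def module_vec_simps class_ring_simps add smult)
  interpret T: linear_map class_ring V "coord_space n" ?T by (rule T)
  have ker: "{v \<in> carrier V. ?T v = \<zero>\<^bsub>coord_space n\<^esub>} = {v \<in> carrier V. \<forall>t<n. f t v = 0}"
    by (auto simp: module_vec_simps vec_eq_iff)
  show "subspace class_ring {v \<in> carrier V. \<forall>t<n. f t v = 0} V"
    using T.kerT_is_subspace unfolding T.ker_def ker .
  show "quotient_dim class_ring V {v \<in> carrier V. \<forall>t<n. f t v = 0} \<le> n"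
    using quotient_dim_kernel_le[OF T V(2) vec_space.fin_dim]
    unfolding ker vec_space.dim_is_n .
qed

section \<open>Coordinates with respect to an ordered basis\<close>

lemma carrier_R_alg: "carrier (R_alg m :: ('a::field, 'a poly) module) = {p. \<forall>j\<ge>m. coeff p j = 0}"
  unfolding R_alg_def by (auto simp: coeff_eq_0) (metis leading_coeff_0_iff not_le)

lemma finsum_R_alg:
  fixes f :: "'b \<Rightarrow> 'a::field poly"
  assumes "f \<in> A \<rightarrow> carrier (R_alg m)"
  shows "finsum (R_alg m) f A = sum f A"
proof -
  interpret vectorspace class_ring "R_alg m :: ('a, 'a poly) module" by (rule R_alg_vs)
  show ?thesis using assms
  proof (induction A rule: infinite_finite_induct)
    case (insert x F)
    then show ?case by (subst finsum_insert) (auto simp: R_alg_def)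
  \<comment> \<open>For infinite \<open>A\<close> both sums are 0 by convention.\<close>
  qed (auto simp: finsum_infinite, auto simp: R_alg_def)
qed

context
  fixes m :: nat and b :: "nat \<Rightarrow> 'a::field poly"
  assumes b: "ordered_basis m b"
begin

lemma ordered_basis_carrier: "j < m \<Longrightarrow> b j \<in> carrier (R_alg m)"
  using b unfolding ordered_basis_def vectorspace.basis_def[OF R_alg_vs] by blast

lemma ordered_basis_sum_carrier: "(\<Sum>j<m. Polynomial.smult (c j) (b j)) \<in> carrier (R_alg m)"
  using ordered_basis_carrier by (auto simp: carrier_R_alg coeff_sum)

lemma ordered_basis_lincomb:
  "module.lincomb (R_alg m) a (b ` {..<m}) = (\<Sum>j<m. Polynomial.smult (a (b j)) (b j))"
proof -
  interpret vectorspace class_ring "R_alg m :: ('a, 'a poly) module" by (rule R_alg_vs)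
  have "lincomb a (b ` {..<m}) = (\<Sum>p\<in>b ` {..<m}. Polynomial.smult (a p) p)"
    unfolding lincomb_def using ordered_basis_carrier
    by (subst finsum_R_alg) (auto simp: carrier_R_alg, auto simp: R_alg_def)
  then show ?thesis
    using b by (simp add: ordered_basis_def sum.reindex)
qed

text \<open>\<open>basis_criterion\<close> gives a unique coefficient function on the set of basis
  elements; injectivity of \<open>b\<close> turns it into a vector indexed by positions. This makes
  the description in \<open>coord_vec\<close> definite.\<close>

lemma ordered_basis_coords_ex1:
  assumes p: "p \<in> carrier (R_alg m)"
  shows "\<exists>!v. v \<in> carrier_vec m \<and> p = (\<Sum>j<m. Polynomial.smult (v $ j) (b j))"
proof -
  interpret vectorspace class_ring "R_alg m :: ('a, 'a poly) module" by (rule R_alg_vs)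
  have inj: "inj_on b {..<m}" and bas: "basis (b ` {..<m})" using b by (auto simp: ordered_basis_def)
  have "b ` {..<m} \<subseteq> carrier (R_alg m)" using ordered_basis_carrier by auto
  from basis_criterion[OF _ this] bas p
  have ex1: "\<exists>!a. a \<in> b ` {..<m} \<rightarrow>\<^sub>E UNIV \<and> lincomb a (b ` {..<m}) = p"
    by (simp add: class_ring_simps)
  then obtain a where a: "lincomb a (b ` {..<m}) = p" by blast
  show ?thesis
  proof (rule ex1I[of _ "vec m (\<lambda>j. a (b j))"])
    show "vec m (\<lambda>j. a (b j)) \<in> carrier_vec m \<and>
        p = (\<Sum>j<m. Polynomial.smult (vec m (\<lambda>j. a (b j)) $ j) (b j))"
      using a by (simp add: ordered_basis_lincomb)
  next
    fix v assume v: "v \<in> carrier_vec m \<and> p = (\<Sum>j<m. Polynomial.smult (v $ j) (b j))"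
    \<comment> \<open>The vector \<open>v\<close> is carried along the inverse of \<open>b\<close>
      to a function on basis elements; \<open>restrict\<close> puts it into the extensional function
      space in which uniqueness holds.\<close>
    define c where "c = restrict (\<lambda>q. v $ the_inv_into {..<m} b q) (b ` {..<m})"
    have cb: "c (b j) = v $ j" if "j < m" for j
      using that inj by (simp add: c_def the_inv_into_f_f)
    have "lincomb c (b ` {..<m}) = p" using v by (simp add: ordered_basis_lincomb cb)
    \<comment> \<open>Restricting \<open>a\<close> leaves the combination unchanged and brings it
      into the same space.\<close>
    moreover have "lincomb (restrict a (b ` {..<m})) (b ` {..<m}) = p"
      using a by (simp add: ordered_basis_lincomb)
    moreover have "c \<in> b ` {..<m} \<rightarrow>\<^sub>E UNIV" by (auto simp: c_def)
    ultimately have "c = restrict a (b ` {..<m})"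
      using ex1 by (metis restrict_PiE_iff UNIV_I)
    then have "v $ j = a (b j)" if "j < m" for j using that cb[OF that] by simp
    then show "v = vec m (\<lambda>j. a (b j))" using v by (auto simp: vec_eq_iff)
  qed
qed

lemma coord_vec_expansion:
  "p \<in> carrier (R_alg m) \<Longrightarrow> (\<Sum>j<m. Polynomial.smult (coord_vec m b p $ j) (b j)) = p"
  using theI'[OF ordered_basis_coords_ex1, of p] unfolding coord_vec_def by auto

lemma coord_vec_sum:
  "v \<in> carrier_vec m \<Longrightarrow> coord_vec m b (\<Sum>j<m. Polynomial.smult (v $ j) (b j)) = v"
  unfolding coord_vec_def
  by (rule the1_equality[OF ordered_basis_coords_ex1]) (auto intro: ordered_basis_sum_carrier)

end

section \<open>Cutting vectors into blocks\<close>

lemma block_index_less: "i < s \<Longrightarrow> j < m \<Longrightarrow> i * m + j < s * (m::nat)"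
  by (metis add.commute mult.commute mult_Suc_right nat_add_left_cancel_less less_le_trans mult_le_mono2 Suc_leI)

lemma concat_blocks_carrier: "concat_blocks s m a \<in> carrier_vec (s * m)"
  by (simp add: concat_blocks_def)

lemma concat_blocks_index: "i < s \<Longrightarrow> j < m \<Longrightarrow> concat_blocks s m a $ (i * m + j) = a i $ j"
  by (simp add: concat_blocks_def block_index_less)

lemma concat_blocks_cong:
  assumes "\<And>i. i < s \<Longrightarrow> a i = a' i"
  shows "concat_blocks s m a = concat_blocks s m a'"
  using assms by (auto simp: concat_blocks_def less_mult_imp_div_less intro!: eq_vecI)

lemma concat_blocks_split:
  assumes v: "v \<in> carrier_vec (s * m)"
  shows "concat_blocks s m (\<lambda>i. vec m (\<lambda>j. v $ (i * m + j))) = v"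
proof (rule eq_vecI)
  fix t assume "t < dim_vec v"
  then have t: "t < s * m" using v by simp
  \<comment> \<open>This gives \<open>t mod m < m\<close>, so the lookup inside a block is in
    range.\<close>
  then have "m > 0" by (cases m) auto
  then show "concat_blocks s m (\<lambda>i. vec m (\<lambda>j. v $ (i * m + j))) $ t = v $ t"
    using t by (simp add: concat_blocks_def)
qed (use v in \<open>simp add: concat_blocks_def\<close>)

section \<open>Membership as vanishing of coefficients\<close>

text \<open>This is the inverse of \<open>theta\<close>, one component at a time: block
  \<open>i\<close> of \<open>v\<close> is read as coordinates over the basis
  \<open>b i\<close>.\<close>

definition block_poly :: "nat \<Rightarrow> (nat \<Rightarrow> nat \<Rightarrow> 'a::field poly) \<Rightarrow> 'a vec \<Rightarrow> nat \<Rightarrow> 'a poly" where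
  "block_poly m b v i = (\<Sum>j<m. Polynomial.smult (v $ (i * m + j)) (b i j))"

text \<open>The series are not truncated, so \<open>t\<close> is not tied to \<open>m\<close>: the
  value at \<open>t = m\<close> makes sense at level \<open>m\<close>, and levels \<open>m\<close>
  and \<open>Suc m\<close> can be compared.\<close>

definition syndrome ::
    "nat \<Rightarrow> nat \<Rightarrow> (nat \<Rightarrow> nat \<Rightarrow> 'a::field poly) \<Rightarrow> (nat \<Rightarrow> 'a fps) \<Rightarrow> nat \<Rightarrow> 'a vec \<Rightarrow> 'a" where
  "syndrome s m b \<alpha> t v = fps_nth (\<Sum>i<s. \<alpha> i * fps_of_poly (block_poly m b v i)) t"

lemma block_poly_add:
  assumes "v \<in> carrier_vec (s * m)" "w \<in> carrier_vec (s * m)" "i < s"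
  shows "block_poly m b (v + w) i = block_poly m b v i + block_poly m b w i"
  using assms by (simp add: block_poly_def block_index_less smult_add_left sum.distrib)

lemma block_poly_smult:
  assumes "v \<in> carrier_vec (s * m)" "i < s"
  shows "block_poly m b (c \<cdot>\<^sub>v v) i = Polynomial.smult c (block_poly m b v i)"
  using assms
  by (intro poly_eqI) (simp add: block_poly_def block_index_less coeff_sum sum_distrib_left mult.assoc)

lemma syndrome_add:
  assumes "v \<in> carrier_vec (s * m)" "w \<in> carrier_vec (s * m)"
  shows "syndrome s m b \<alpha> t (v + w) = syndrome s m b \<alpha> t v + syndrome s m b \<alpha> t w"
  using assms
  by (simp add: syndrome_def block_poly_add fps_of_poly_add distrib_left sum.distrib fps_sum_nth)

lemma syndrome_smult:
  assumes "v \<in> carrier_vec (s * m)"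
  shows "syndrome s m b \<alpha> t (c \<cdot>\<^sub>v v) = c * syndrome s m b \<alpha> t v"
  using assms
  by (simp add: syndrome_def block_poly_smult fps_of_poly_smult fps_sum_nth sum_distrib_left
      mult.left_commute[of _ "fps_const c"])

text \<open>Divisibility by \<open>monom 1 m\<close> concerns the coefficients below
  \<open>m\<close>, and those of a product depend only on coefficients below \<open>m\<close> of its
  factors.\<close>

lemma cong_truncate_iff:
  fixes \<alpha> :: "nat \<Rightarrow> 'a::field fps"
  shows "[(\<Sum>i<s. truncate_fps m (\<alpha> i) * k i) = 0] (mod (monom 1 m)) \<longleftrightarrow>
    (\<forall>t<m. fps_nth (\<Sum>i<s. \<alpha> i * fps_of_poly (k i)) t = 0)"
proof -
  have "coeff (\<Sum>i<s. truncate_fps m (\<alpha> i) * k i) t = fps_nth (\<Sum>i<s. \<alpha> i * fps_of_poly (k i)) t"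
    if "t < m" for t
    using that by (simp add: coeff_sum coeff_mult fps_sum_nth fps_mult_nth atLeast0AtMost)
  then show ?thesis by (simp add: cong_0_iff monom_1_dvd_iff')
qed

text \<open>Since \<open>block_poly\<close> and \<open>theta\<close> are mutually inverse,
  membership of \<open>v\<close> can be tested on the polynomials that its blocks encode.\<close>

lemma N_space_eq_syndrome_kernel:
  assumes b: "\<And>i. i < s \<Longrightarrow> ordered_basis m (B m i)"
  shows "N_space s B \<alpha> m = {v \<in> carrier_vec (s * m). \<forall>t<m. syndrome s m (B m) \<alpha> t v = 0}"
proof (intro equalityI subsetI)
  fix v assume "v \<in> N_space s B \<alpha> m"
  then obtain k where k: "\<And>i. i < s \<Longrightarrow> k i \<in> carrier (R_alg m)"
    and ker: "\<forall>t<m. fps_nth (\<Sum>i<s. \<alpha> i * fps_of_poly (k i)) t = 0"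
    and v: "v = theta s B m k"
    by (auto simp: N_space_def N_prime_def cong_truncate_iff)
  have "block_poly m (B m) v i = k i" if "i < s" for i
    using that coord_vec_expansion[OF b k]
    by (simp add: block_poly_def v theta_def concat_blocks_index)
  with ker show "v \<in> {v \<in> carrier_vec (s * m). \<forall>t<m. syndrome s m (B m) \<alpha> t v = 0}"
    by (simp add: syndrome_def v theta_def concat_blocks_carrier)
next
  fix v assume v: "v \<in> {v \<in> carrier_vec (s * m). \<forall>t<m. syndrome s m (B m) \<alpha> t v = 0}"
  \<comment> \<open>The restriction is there because \<open>N_prime\<close> consists of extensional
    functions.\<close>
  define k where "k = restrict (block_poly m (B m) v) {..<s}"
  have "block_poly m (B m) v i \<in> carrier (R_alg m)" if "i < s" for i
    unfolding block_poly_def by (rule ordered_basis_sum_carrier[OF b[OF that]])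
  with v have "k \<in> N_prime s \<alpha> m"
    by (auto simp: N_prime_def cong_truncate_iff syndrome_def k_def)
  moreover have "theta s B m k = v"
  proof -
    have "coord_vec m (B m i) (k i) = vec m (\<lambda>j. v $ (i * m + j))" if "i < s" for i
      using coord_vec_sum[OF b[OF that], of "vec m (\<lambda>j. v $ (i * m + j))"] that
      by (simp add: k_def block_poly_def)
    then have "theta s B m k = concat_blocks s m (\<lambda>i. vec m (\<lambda>j. v $ (i * m + j)))"
      unfolding theta_def by (rule concat_blocks_cong)
    then show ?thesis using v concat_blocks_split by auto
  qed
  ultimately show "v \<in> N_space s B \<alpha> m" unfolding N_space_def by blast
qed

section \<open>Passing between the levels \<open>m\<close> and \<open>Suc m\<close>\<close>

lemma nested_bases_Suc:
  assumes B: "nested_bases s B" and "m \<ge> 1" "i < s" "j < m"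
  shows "B (Suc m) i j = B m i j"
proof (rule poly_eqI)
  fix t
  have "B (Suc m) i j \<in> carrier (R_alg (Suc m))" and Bm: "B m i j \<in> carrier (R_alg m)"
    using assms by (auto intro!: ordered_basis_carrier simp: nested_bases_def)
  moreover have "coeff (B (Suc m) i j) t = coeff (B m i j) t" if t: "t < Suc m"
  proof -
    have "vec (Suc m) (coeff (B (Suc m) i j)) $ t = (vec m (coeff (B m i j)) @\<^sub>v 0\<^sub>v 1) $ t"
      using assms by (simp add: nested_bases_def)
    \<comment> \<open>At \<open>t = m\<close> the appended 0 meets coefficient \<open>m\<close> of
      \<open>B m i j\<close>, which vanishes by the degree bound.\<close>
    then show ?thesis using t Bm by (auto simp: carrier_R_alg split: if_splits)
  qed
  ultimately show "coeff (B (Suc m) i j) t = coeff (B m i j) t"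
    by (cases "t < Suc m") (auto simp: carrier_R_alg)
qed

text \<open>The appended zeros remove the last basis element of each block, and the others agree by
  nestedness; so both vectors encode the same polynomials.\<close>

lemma syndrome_concat_blocks_Suc:
  assumes B: "nested_bases s B" "m \<ge> 1" and a: "\<forall>i<s. a i \<in> carrier_vec m"
  shows "syndrome s (Suc m) (B (Suc m)) \<alpha> t (concat_blocks s (Suc m) (\<lambda>i. a i @\<^sub>v 0\<^sub>v 1)) =
    syndrome s m (B m) \<alpha> t (concat_blocks s m a)"
proof -
  have "block_poly (Suc m) (B (Suc m)) (concat_blocks s (Suc m) (\<lambda>i. a i @\<^sub>v 0\<^sub>v 1)) i =
      block_poly m (B m) (concat_blocks s m a) i" if i: "i < s" for i
  proof -
    have "a i \<in> carrier_vec m" using a i by blast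
    then show ?thesis
      unfolding block_poly_def
      \<comment> \<open>Keeping \<open>i * Suc m\<close> unexpanded lets
        \<open>concat_blocks_index\<close> match.\<close>
      by (simp add: concat_blocks_index i nested_bases_Suc[OF B i] del: mult_Suc_right)
  qed
  then show ?thesis by (simp add: syndrome_def)
qed

text \<open>The conditions at level \<open>Suc m\<close> are those for \<open>t < m\<close>, which
  define the space at level \<open>m\<close>, and one for \<open>t = m\<close>. Writing the latter
  as \<open>m + t\<close> with \<open>t < 1\<close> fits
  \<open>common_kernel_of_functionals\<close>.\<close>

lemma shortened_N_space:
  assumes B: "nested_bases s B" and m: "m \<ge> 1"
  shows "shortened s m (N_space s B \<alpha> (Suc m)) =
    {v \<in> N_space s B \<alpha> m. \<forall>t<1. syndrome s m (B m) \<alpha> (m + t) v = 0}"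
proof -
  have N: "N_space s B \<alpha> n = {v \<in> carrier_vec (s * n). \<forall>t<n. syndrome s n (B n) \<alpha> t v = 0}"
    if "n \<ge> 1" for n
    using B that by (intro N_space_eq_syndrome_kernel) (auto simp: nested_bases_def)
  have "shortened s m (N_space s B \<alpha> (Suc m)) =
      {concat_blocks s m a | a. (\<forall>i<s. a i \<in> carrier_vec m) \<and>
        (\<forall>t<Suc m. syndrome s m (B m) \<alpha> t (concat_blocks s m a) = 0)}"
    unfolding shortened_def
    \<comment> \<open>\<open>conj_cong\<close> supplies the block lengths that
      \<open>syndrome_concat_blocks_Suc\<close> assumes; without \<open>One_nat_def\<close> the term
      \<open>0\<^sub>v 1\<close> keeps its form.\<close>
    by (simp add: N concat_blocks_carrier syndrome_concat_blocks_Suc[OF B m]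
        del: mult_Suc_right One_nat_def cong: conj_cong)
  also have "\<dots> = {v \<in> carrier_vec (s * m). \<forall>t<Suc m. syndrome s m (B m) \<alpha> t v = 0}"
    (is "?L = ?R")
  proof
    show "?L \<subseteq> ?R" by (auto simp: concat_blocks_carrier)
    show "?R \<subseteq> ?L"
    proof
      fix v assume v: "v \<in> ?R"
      then have "concat_blocks s m (\<lambda>i. vec m (\<lambda>j. v $ (i * m + j))) = v"
        by (simp add: concat_blocks_split)
      with v show "v \<in> ?L"
        \<comment> \<open>The witness consists of the blocks of \<open>v\<close>.\<close>
        by (intro CollectI exI[of _ "\<lambda>i. vec m (\<lambda>j. v $ (i * m + j))"]) simp
    qed
  qed
  also have "\<dots> = {v \<in> N_space s B \<alpha> m. \<forall>t<1. syndrome s m (B m) \<alpha> (m + t) v = 0}"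
    using m by (auto simp: N less_Suc_eq)
  finally show ?thesis .
qed

theorem theorem5:
  fixes q s :: nat
    and B :: "nat \<Rightarrow> nat \<Rightarrow> nat \<Rightarrow> 'a::{field,finite} poly"
    and \<alpha> :: "nat \<Rightarrow> 'a fps"
  assumes "card (UNIV :: 'a set) = q"
    and "s \<ge> 2"
    and "nested_bases s B"
    and "\<alpha> \<in> {..<s} \<rightarrow> Y_set"
  shows "dual_space_chain s (\<lambda>m. N_space s B \<alpha> m)"
proof -
  note B = assms(3)
  have chain: "subspace class_ring (N_space s B \<alpha> m) (coord_space (s * m)) \<and>
      quotient_dim class_ring (coord_space (s * m)) (N_space s B \<alpha> m) \<le> m \<and>
      subspace class_ring (shortened s m (N_space s B \<alpha> (Suc m)))
        ((coord_space (s * m))\<lparr>carrier := N_space s B \<alpha> m\<rparr>) \<and>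
      quotient_dim class_ring ((coord_space (s * m))\<lparr>carrier := N_space s B \<alpha> m\<rparr>)
        (shortened s m (N_space s B \<alpha> (Suc m))) \<le> 1" if m: "m \<ge> 1" for m
  proof -
    let ?V = "coord_space (s * m) :: ('a, 'a vec) module"
    let ?N = "N_space s B \<alpha> m"
    have N: "?N = {v \<in> carrier_vec (s * m). \<forall>t<m. syndrome s m (B m) \<alpha> t v = 0}"
      using B m by (intro N_space_eq_syndrome_kernel) (auto simp: nested_bases_def)
    interpret V: vectorspace class_ring ?V by (rule vec_vs)
    have sub: "subspace class_ring ?N ?V" and codim: "quotient_dim class_ring ?V ?N \<le> m"
      using common_kernel_of_functionals[of ?V m "syndrome s m (B m) \<alpha>",
          OF vec_vs vec_space.fin_dim]
      by (simp_all add: N module_vec_simps syndrome_add syndrome_smult)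
    \<comment> \<open>Now \<open>?N\<close> itself is the ambient space, and the single functional
      is the coefficient of \<open>x^m\<close>.\<close>
    have "subspace class_ring {v \<in> carrier (?V\<lparr>carrier := ?N\<rparr>).
          \<forall>t<1. syndrome s m (B m) \<alpha> (m + t) v = 0} (?V\<lparr>carrier := ?N\<rparr>)"
      "quotient_dim class_ring (?V\<lparr>carrier := ?N\<rparr>) {v \<in> carrier (?V\<lparr>carrier := ?N\<rparr>).
          \<forall>t<1. syndrome s m (B m) \<alpha> (m + t) v = 0} \<le> 1"
      by (rule common_kernel_of_functionals[OF V.subspace_is_vs[OF sub]
            V.subspace_fin_dim[OF sub vec_space.fin_dim]];
          simp add: N module_vec_simps syndrome_add syndrome_smult)+
    with sub codim show ?thesis by (simp add: shortened_N_space[OF B m])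
  qed
  then show ?thesis unfolding dual_space_chain_def by blast
qed

end
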